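(* Let $(\mathfrak g,\mu,T,B)$ be a quadratic Hom-Lie algebra over $\mathbb F$ with $T$ in its centroid and $\dim\operatorname{Ker}(T)=r>0$, let $V$ be an $r$-dimensional vector space, and let $(\mathfrak G=\mathfrak g\oplus V,[\,\cdot\,,\,\cdot\,]_{\mathfrak G},B_{\mathfrak G})$ and $k:\mathfrak g\to\mathfrak G$ be the quadratic Lie algebra and the linear map constructed in the context. Define $\mu_{\mathfrak G}:\mathfrak G\times\mathfrak G\to\mathfrak G$ and $L:\mathfrak G\to\mathfrak G$ by $$\mu_{\mathfrak G}(x+u,y+v)=\mu(x,y),\qquad L(x+u)=k(x),\qquad x,y\in\mathfrak g,\ u,v\in V.$$ Then $(\mathfrak G,\mu_{\mathfrak G},L)$ is a Hom-Lie algebra, and $$B_{\mathfrak G}(L(x+u),y+v)=B_{\mathfrak G}(x+u,L(y+v))=B(x,y)$$ for all $x,y\in\mathfrak g$ and $u,v\in V$. Moreover, the projection $\pi:\mathfrak G\to\mathfrak g$, $\pi(x+v)=x$, is an epimorphism of Hom-Lie algebras $(\mathfrak G,\mu_{\mathfrak G},L)\to(\mathfrak g,\mu,T)$.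
   Context: All vector spaces are finite dimensional over an algebraically closed field $\mathbb F$ of characteristic zero. A Hom-Lie algebra is a triple $(\mathfrak g,\mu,T)$ with $\mathfrak g$ a vector space, $\mu:\mathfrak g\times\mathfrak g\to\mathfrak g$ bilinear and skew-symmetric, and $T:\mathfrak g\to\mathfrak g$ linear, such that $\mu(T(x),\mu(y,z))+\mu(T(y),\mu(z,x))+\mu(T(z),\mu(x,y))=0$ for all $x,y,z\in\mathfrak g$. A morphism of Hom-Lie algebras $(\mathfrak g_1,\mu_1,T_1)\to(\mathfrak g_2,\mu_2,T_2)$ is a linear map $\psi$ with $\psi(\mu_1(x,y))=\mu_2(\psi(x),\psi(y))$ and $\psi\circ T_1=T_2\circ\psi$; an epimorphism is a surjective morphism. $T$ is in the centroid of $(\mathfrak g,\mu)$ if $T(\mu(x,y))=\mu(T(x),y)$ for all $x,y$. A quadratic Hom-Lie algebra $(\mathfrak g,\mu,T,B)$ is a Hom-Lie algebra with a symmetric non-degenerate bilinear form $B$ on $\mathfrak g$ such that $B(\mu(x,y),z)=B(x,\mu(y,z))$ and $B(T(x),y)=B(x,T(y))$ for all $x,y,z$. Construction of $\mathfrak G$. Choose a subspace $\mathfrak a\subset\mathfrak g$ complementary to $\operatorname{Im}(T)$ (so $\dim\mathfrak a=r$), a basis $a_1,\dots,a_r$ of $\mathfrak a$ and a basis $v_1,\dots,v_r$ of $V$. Define $k:\mathfrak g\to\mathfrak G$ by $k(x)=T(x)+B(a_1,x)v_1+\cdots+B(a_r,x)v_r$, and $[x+u,y+v]_{\mathfrak G}=k(\mu(x,y))$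 for $x,y\in\mathfrak g$, $u,v\in V$. Define the symmetric bilinear form $B_{\mathfrak G}$ on $\mathfrak G=\mathfrak a\oplus\operatorname{Im}(T)\oplus V$ by $B_{\mathfrak G}(T(x),T(y))=B(T(x),y)$; $B_{\mathfrak G}(\mathfrak a\oplus V,\operatorname{Im}(T))=B_{\mathfrak G}(\mathfrak a,\mathfrak a)=B_{\mathfrak G}(V,V)=\{0\}$; $B_{\mathfrak G}(a_i,v_j)=\delta_{ij}$. Then $(\mathfrak G,[\,\cdot\,,\,\cdot\,]_{\mathfrak G},B_{\mathfrak G})$ is a quadratic Lie algebra (a Lie algebra with a non-degenerate symmetric invariant bilinear form). *)

theory Defs
  imports "HOL-Analysis.Product_Vector" "HOL-Computational_Algebra.Polynomial"
begin

text \<open>A vector space is a whole type together with a scalar multiplication. For such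
  \<open>sg\<close> and \<open>sv\<close>, the direct sum \<open>\<GG> = \<gg> \<oplus> V\<close> is the product type with scalar multiplication
  \<open>module_prod.scale sg sv\<close>; the element \<open>x + u\<close> is \<open>(x, u)\<close>.\<close>

definition fin_dim :: "('f::field \<Rightarrow> 'g::ab_group_add \<Rightarrow> 'g) \<Rightarrow> bool" where
  "fin_dim s \<longleftrightarrow> (\<exists>Bas. finite_dimensional_vector_space s Bas)"

definition bilinear_map ::
    "('f::field \<Rightarrow> 'g::ab_group_add \<Rightarrow> 'g) \<Rightarrow> ('f \<Rightarrow> 'h::ab_group_add \<Rightarrow> 'h) \<Rightarrow> ('g \<Rightarrow> 'g \<Rightarrow> 'h) \<Rightarrow> bool" where
  "bilinear_map s s' f \<longleftrightarrow>
     (\<forall>x. Vector_Spaces.linear s s' (\<lambda>y. f x y)) \<and> (\<forall>y. Vector_Spaces.linear s s' (\<lambda>x. f x y))"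

definition symmetric_bilinear_form ::
    "('f::field \<Rightarrow> 'g::ab_group_add \<Rightarrow> 'g) \<Rightarrow> ('g \<Rightarrow> 'g \<Rightarrow> 'f) \<Rightarrow> bool" where
  "symmetric_bilinear_form s B \<longleftrightarrow> bilinear_map s (*) B \<and> (\<forall>x y. B x y = B y x)"

definition nondegenerate_form :: "('g::ab_group_add \<Rightarrow> 'g \<Rightarrow> 'f::field) \<Rightarrow> bool" where
  "nondegenerate_form B \<longleftrightarrow> (\<forall>x. (\<forall>y. B x y = 0) \<longrightarrow> x = 0)"

definition hom_lie_algebra ::
    "('f::field \<Rightarrow> 'g::ab_group_add \<Rightarrow> 'g) \<Rightarrow> ('g \<Rightarrow> 'g \<Rightarrow> 'g) \<Rightarrow> ('g \<Rightarrow> 'g) \<Rightarrow> bool" where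
  "hom_lie_algebra s \<mu> T \<longleftrightarrow>
     fin_dim s \<and> bilinear_map s s \<mu> \<and> (\<forall>x y. \<mu> x y = - \<mu> y x) \<and> Vector_Spaces.linear s s T \<and>
     (\<forall>x y z. \<mu> (T x) (\<mu> y z) + \<mu> (T y) (\<mu> z x) + \<mu> (T z) (\<mu> x y) = 0)"

definition hom_lie_morphism ::
    "('f::field \<Rightarrow> 'g::ab_group_add \<Rightarrow> 'g) \<Rightarrow> ('g \<Rightarrow> 'g \<Rightarrow> 'g) \<Rightarrow> ('g \<Rightarrow> 'g) \<Rightarrow>
     ('f \<Rightarrow> 'h::ab_group_add \<Rightarrow> 'h) \<Rightarrow> ('h \<Rightarrow> 'h \<Rightarrow> 'h) \<Rightarrow> ('h \<Rightarrow> 'h) \<Rightarrow> ('g \<Rightarrow> 'h) \<Rightarrow> bool" where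
  "hom_lie_morphism s1 \<mu>1 T1 s2 \<mu>2 T2 \<psi> \<longleftrightarrow>
     hom_lie_algebra s1 \<mu>1 T1 \<and> hom_lie_algebra s2 \<mu>2 T2 \<and> Vector_Spaces.linear s1 s2 \<psi> \<and>
     (\<forall>x y. \<psi> (\<mu>1 x y) = \<mu>2 (\<psi> x) (\<psi> y)) \<and> \<psi> \<circ> T1 = T2 \<circ> \<psi>"

definition hom_lie_epimorphism ::
    "('f::field \<Rightarrow> 'g::ab_group_add \<Rightarrow> 'g) \<Rightarrow> ('g \<Rightarrow> 'g \<Rightarrow> 'g) \<Rightarrow> ('g \<Rightarrow> 'g) \<Rightarrow>
     ('f \<Rightarrow> 'h::ab_group_add \<Rightarrow> 'h) \<Rightarrow> ('h \<Rightarrow> 'h \<Rightarrow> 'h) \<Rightarrow> ('h \<Rightarrow> 'h) \<Rightarrow> ('g \<Rightarrow> 'h) \<Rightarrow> bool" where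
  "hom_lie_epimorphism s1 \<mu>1 T1 s2 \<mu>2 T2 \<psi> \<longleftrightarrow>
     hom_lie_morphism s1 \<mu>1 T1 s2 \<mu>2 T2 \<psi> \<and> surj \<psi>"

definition in_centroid :: "('g::ab_group_add \<Rightarrow> 'g \<Rightarrow> 'g) \<Rightarrow> ('g \<Rightarrow> 'g) \<Rightarrow> bool" where
  "in_centroid \<mu> T \<longleftrightarrow> (\<forall>x y. T (\<mu> x y) = \<mu> (T x) y)"

definition quadratic_hom_lie_algebra ::
    "('f::field \<Rightarrow> 'g::ab_group_add \<Rightarrow> 'g) \<Rightarrow> ('g \<Rightarrow> 'g \<Rightarrow> 'g) \<Rightarrow> ('g \<Rightarrow> 'g) \<Rightarrow> ('g \<Rightarrow> 'g \<Rightarrow> 'f) \<Rightarrow> bool" where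
  "quadratic_hom_lie_algebra s \<mu> T B \<longleftrightarrow>
     hom_lie_algebra s \<mu> T \<and> symmetric_bilinear_form s B \<and> nondegenerate_form B \<and>
     (\<forall>x y z. B (\<mu> x y) z = B x (\<mu> y z)) \<and> (\<forall>x y. B (T x) y = B x (T y))"

definition lie_algebra ::
    "('f::field \<Rightarrow> 'g::ab_group_add \<Rightarrow> 'g) \<Rightarrow> ('g \<Rightarrow> 'g \<Rightarrow> 'g) \<Rightarrow> bool" where
  "lie_algebra s br \<longleftrightarrow>
     fin_dim s \<and> bilinear_map s s br \<and> (\<forall>x. br x x = 0) \<and>
     (\<forall>x y z. br x (br y z) + br y (br z x) + br z (br x y) = 0)"

definition quadratic_lie_algebra ::
    "('f::field \<Rightarrow> 'g::ab_group_add \<Rightarrow> 'g) \<Rightarrow> ('g \<Rightarrow> 'g \<Rightarrow> 'g) \<Rightarrow> ('g \<Rightarrow> 'g \<Rightarrow> 'f) \<Rightarrow> bool" where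
  "quadratic_lie_algebra s br B \<longleftrightarrow>
     lie_algebra s br \<and> symmetric_bilinear_form s B \<and> nondegenerate_form B \<and>
     (\<forall>x y z. B (br x y) z = B x (br y z))"

definition complementary_subspace ::
    "('f::field \<Rightarrow> 'g::ab_group_add \<Rightarrow> 'g) \<Rightarrow> 'g set \<Rightarrow> 'g set \<Rightarrow> bool" where
  "complementary_subspace s A W \<longleftrightarrow>
     module.subspace s A \<and> A \<inter> W = {0} \<and> {x + y | x y. x \<in> A \<and> y \<in> W} = UNIV"

definition indexed_basis ::
    "('f::field \<Rightarrow> 'g::ab_group_add \<Rightarrow> 'g) \<Rightarrow> nat \<Rightarrow> (nat \<Rightarrow> 'g) \<Rightarrow> 'g set \<Rightarrow> bool" where
  "indexed_basis s r b W \<longleftrightarrow>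
     inj_on b {1..r} \<and> \<not> module.dependent s (b ` {1..r}) \<and> module.span s (b ` {1..r}) = W"

definition k_map ::
    "('f::field \<Rightarrow> 'v::ab_group_add \<Rightarrow> 'v) \<Rightarrow> ('g \<Rightarrow> 'g) \<Rightarrow> ('g \<Rightarrow> 'g \<Rightarrow> 'f) \<Rightarrow> nat \<Rightarrow>
     (nat \<Rightarrow> 'g) \<Rightarrow> (nat \<Rightarrow> 'v) \<Rightarrow> 'g \<Rightarrow> 'g \<times> 'v" where
  "k_map sv T B r a v x = (T x, \<Sum>i=1..r. sv (B (a i) x) (v i))"

definition bracket_G :: "('g \<Rightarrow> 'g \<times> 'v) \<Rightarrow> ('g \<Rightarrow> 'g \<Rightarrow> 'g) \<Rightarrow> 'g \<times> 'v \<Rightarrow> 'g \<times> 'v \<Rightarrow> 'g \<times> 'v" where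
  "bracket_G k \<mu> X Y = k (\<mu> (fst X) (fst Y))"

text \<open>The conditions defining \<open>B\<^sub>\<GG>\<close>. Exactly one form satisfies them (\<open>form_G_ex1\<close>),
  and it makes \<open>\<GG>\<close> with \<open>bracket_G\<close> a quadratic Lie algebra (\<open>quadratic_lie_algebra_G\<close>).\<close>

definition is_form_G ::
    "('f::field \<Rightarrow> 'g::ab_group_add \<Rightarrow> 'g) \<Rightarrow> ('f \<Rightarrow> 'v::ab_group_add \<Rightarrow> 'v) \<Rightarrow> ('g \<Rightarrow> 'g) \<Rightarrow> ('g \<Rightarrow> 'g \<Rightarrow> 'f) \<Rightarrow>
     'g set \<Rightarrow> nat \<Rightarrow> (nat \<Rightarrow> 'g) \<Rightarrow> (nat \<Rightarrow> 'v) \<Rightarrow> ('g \<times> 'v \<Rightarrow> 'g \<times> 'v \<Rightarrow> 'f) \<Rightarrow> bool" where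
  "is_form_G sg sv T B A r a v BG \<longleftrightarrow>
     symmetric_bilinear_form (module_prod.scale sg sv) BG \<and>
     (\<forall>x y. BG (T x, 0) (T y, 0) = B (T x) y) \<and>
     (\<forall>\<alpha>\<in>A. \<forall>u. \<forall>\<tau>\<in>range T. BG (\<alpha>, u) (\<tau>, 0) = 0) \<and>
     (\<forall>\<alpha>\<in>A. \<forall>\<beta>\<in>A. BG (\<alpha>, 0) (\<beta>, 0) = 0) \<and>
     (\<forall>u w. BG (0, u) (0, w) = 0) \<and>
     (\<forall>i\<in>{1..r}. \<forall>j\<in>{1..r}. BG (a i, 0) (0, v j) = (if i = j then 1 else 0))"

definition mu_G :: "('g \<Rightarrow> 'g \<Rightarrow> 'g) \<Rightarrow> 'g \<times> 'v \<Rightarrow> 'g \<times> 'v \<Rightarrow> 'g \<times> 'v::zero" where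
  "mu_G \<mu> X Y = (\<mu> (fst X) (fst Y), 0)"

definition L_G :: "('g \<Rightarrow> 'g \<times> 'v) \<Rightarrow> 'g \<times> 'v \<Rightarrow> 'g \<times> 'v" where
  "L_G k X = k (fst X)"


lemma linear_form_sum:
  assumes "Vector_Spaces.linear s (*) f"
  shows "f (\<Sum>i\<in>I. s (c i) (b i)) = (\<Sum>i\<in>I. c i * f (b i))"
proof -
  interpret Vector_Spaces.linear s "(*)" f by fact
  show ?thesis by (simp add: sum scale)
qed

lemma indexed_basis_coords:
  assumes "vector_space s" and "indexed_basis s r b W"
  shows "\<exists>c. (\<forall>x\<in>W. x = (\<Sum>i=1..r. s (c i x) (b i))) \<and>
    (\<forall>i. \<forall>x\<in>W. \<forall>y\<in>W. c i (x + y) = c i x + c i y) \<and>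
    (\<forall>i. \<forall>t. \<forall>x\<in>W. c i (s t x) = t * c i x) \<and>
    (\<forall>i\<in>{1..r}. \<forall>j\<in>{1..r}. c i (b j) = (if i = j then 1 else 0))"
proof -
  interpret vector_space s by fact
  from assms(2) have inj: "inj_on b {1..r}" and ind: "independent (b ` {1..r})"
    and sp: "span (b ` {1..r}) = W"
    by (auto simp: indexed_basis_def)
  define c where "c i x = representation (b ` {1..r}) x (b i)" for i x
  have 1: "x = (\<Sum>i=1..r. s (c i x) (b i))" if "x \<in> W" for x
  proof -
    have "(\<Sum>w\<in>b ` {1..r}. s (representation (b ` {1..r}) x w) w) = x"
      by (rule sum_representation_eq) (use ind that sp in auto)
    then show ?thesis unfolding sum.reindex[OF inj] c_def by simp
  qed
  have 2: "c i (x + y) = c i x + c i y" if "x \<in> W" "y \<in> W" for i x y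
    using that ind sp by (simp add: c_def representation_add)
  have 3: "c i (s t x) = t * c i x" if "x \<in> W" for i t x
    using that ind sp by (simp add: c_def representation_scale)
  have 4: "c i (b j) = (if i = j then 1 else 0)" if "i \<in> {1..r}" "j \<in> {1..r}" for i j
  proof -
    have "b i = b j \<longleftrightarrow> i = j" using inj that by (rule inj_on_eq_iff)
    moreover have "representation (b ` {1..r}) (b j) = (\<lambda>w. if w = b j then 1 else 0)"
      using ind that(2) by (intro representation_basis) auto
    ultimately show ?thesis unfolding c_def by simp
  qed
  show ?thesis by (intro exI[of _ c] conjI allI ballI) (rule 1 2 3 4, assumption+)+
qed

locale form_G_setting =
  fixes sg :: "'f::field_char_0 \<Rightarrow> 'g::ab_group_add \<Rightarrow> 'g"
    and \<mu> :: "'g \<Rightarrow> 'g \<Rightarrow> 'g" and T :: "'g \<Rightarrow> 'g" and B :: "'g \<Rightarrow> 'g \<Rightarrow> 'f"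
    and sv :: "'f \<Rightarrow> 'v::ab_group_add \<Rightarrow> 'v"
    and r :: nat and A :: "'g set" and a :: "nat \<Rightarrow> 'g" and v :: "nat \<Rightarrow> 'v"
  assumes quad: "quadratic_hom_lie_algebra sg \<mu> T B"
    and fin_dim_V: "fin_dim sv"
    and compl: "complementary_subspace sg A (range T)"
    and basis_a: "indexed_basis sg r a A"
    and basis_v: "indexed_basis sv r v UNIV"
begin

lemma vector_space_g: "vector_space sg"
  using quad by (auto simp: quadratic_hom_lie_algebra_def hom_lie_algebra_def fin_dim_def
      finite_dimensional_vector_space_def)

lemma vector_space_V: "vector_space sv"
  using fin_dim_V by (auto simp: fin_dim_def finite_dimensional_vector_space_def)

sublocale vector_space_prod sg sv
  by (intro vector_space_prod.intro vector_space_pair.intro vector_space_g vector_space_V)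

lemma linear_T: "Vector_Spaces.linear sg sg T"
  using quad by (simp add: quadratic_hom_lie_algebra_def hom_lie_algebra_def)

lemma T_add: "T (x + y) = T x + T y" and T_scale: "T (sg t x) = sg t (T x)"
  using linear_T by (simp_all add: Vector_Spaces.linear_iff)

lemma linear_B: "Vector_Spaces.linear sg (*) (\<lambda>y. B x y)" "Vector_Spaces.linear sg (*) (\<lambda>x. B x y)"
  using quad by (simp_all add: quadratic_hom_lie_algebra_def symmetric_bilinear_form_def bilinear_map_def)

lemma B_add: "B (x + x') y = B x y + B x' y" "B x (y + y') = B x y + B x y'"
  and B_scale: "B (sg t x) y = t * B x y" "B x (sg t y) = t * B x y"
  using linear_B by (simp_all add: Vector_Spaces.linear_iff)

lemma B_sym: "B x y = B y x"
  and B_T: "B (T x) y = B x (T y)"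
  and B_inv: "B (\<mu> x y) z = B x (\<mu> y z)"
  and B_nondeg: "(\<And>y. B x y = 0) \<Longrightarrow> x = 0"
  using quad by (auto simp: quadratic_hom_lie_algebra_def symmetric_bilinear_form_def nondegenerate_form_def)

lemma B_T_cong: "T y = T y' \<Longrightarrow> B (T x) y = B (T x) y'"
  by (simp add: B_T)

lemma scale_G: "module_prod.scale sg sv t (x, u) = (sg t x, sv t u)"
  by (rule scale_prod)

lemma decomposition:
  obtains pr w where "\<And>x. pr x \<in> A" "\<And>x. x = pr x + T (w x)"
    "\<And>x y. pr (x + y) = pr x + pr y" "\<And>x y. T (w (x + y)) = T (w x) + T (w y)"
    "\<And>t x. pr (sg t x) = sg t (pr x)" "\<And>t x. T (w (sg t x)) = sg t (T (w x))"
    "\<And>x. x \<in> A \<Longrightarrow> pr x = x" "\<And>x. x \<in> A \<Longrightarrow> T (w x) = 0"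
    "\<And>x. pr (T x) = 0" "\<And>x. T (w (T x)) = T x"
proof -
  from compl have A: "vs1.subspace A" and int: "A \<inter> range T = {0}"
    and sum: "{x + y | x y. x \<in> A \<and> y \<in> range T} = UNIV"
    by (auto simp: complementary_subspace_def)
  interpret T: Vector_Spaces.linear sg sg T by (rule linear_T)
  have "\<exists>p. fst p \<in> A \<and> x = fst p + T (snd p)" for x
    using sum by (force simp: set_eq_iff)
  then obtain p where p: "\<And>x. fst (p x) \<in> A \<and> x = fst (p x) + T (snd (p x))" by metis
  define pr where "pr x = fst (p x)" for x
  define w where "w x = snd (p x)" for x
  have prA: "pr x \<in> A" and dec: "x = pr x + T (w x)" for x
    using p[of x] by (auto simp: pr_def w_def)
  have uniq: "pr x = \<alpha> \<and> T (w x) = T z" if "x = \<alpha> + T z" "\<alpha> \<in> A" for x \<alpha> z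
  proof -
    have "pr x + T (w x) = \<alpha> + T z" using dec that by simp
    then have *: "pr x - \<alpha> = T (z - w x)" by (simp add: T.diff algebra_simps)
    have "pr x - \<alpha> \<in> A \<inter> range T"
      using vs1.subspace_diff[OF A prA[of x] that(2)] * by auto
    with int have "pr x - \<alpha> = 0" by blast
    then show ?thesis using * by (simp add: T.diff)
  qed
  have add: "pr (x + y) = pr x + pr y \<and> T (w (x + y)) = T (w x + w y)" for x y
  proof (rule uniq)
    have "x + y = (pr x + T (w x)) + (pr y + T (w y))" using dec by metis
    then show "x + y = pr x + pr y + T (w x + w y)" by (simp add: T.add algebra_simps)
    show "pr x + pr y \<in> A" by (intro vs1.subspace_add A prA)
  qed
  have scl: "pr (sg t x) = sg t (pr x) \<and> T (w (sg t x)) = T (sg t (w x))" for t x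
  proof (rule uniq)
    have "sg t x = sg t (pr x + T (w x))" using dec by metis
    then show "sg t x = sg t (pr x) + T (sg t (w x))" by (simp add: T.scale vs1.scale_right_distrib)
    show "sg t (pr x) \<in> A" by (intro vs1.subspace_scale A prA)
  qed
  have inA: "pr x = x \<and> T (w x) = T 0" if "x \<in> A" for x
    by (rule uniq) (use that in \<open>simp_all add: T.zero\<close>)
  have inT: "pr (T x) = 0 \<and> T (w (T x)) = T x" for x
    by (rule uniq) (use vs1.subspace_0[OF A] in simp_all)
  show thesis
    by (rule that[of pr w, OF prA dec]) (simp_all add: add scl inA inT T.add T.scale T.zero)
qed

lemma form_formula:
  obtains pr w ca cv where
    "\<And>x. x = pr x + T (w x)" "\<And>x. pr (T x) = 0" "\<And>x. T (w (T x)) = T x"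
    "\<And>x. pr x = (\<Sum>i=1..r. sg (ca i x) (a i))"
    "\<And>u. u = (\<Sum>i=1..r. sv (cv i u) (v i))"
    "\<And>i j. i \<in> {1..r} \<Longrightarrow> j \<in> {1..r} \<Longrightarrow> cv i (v j) = (if i = j then 1 else 0)"
    "\<And>i u u'. cv i (u + u') = cv i u + cv i u'" "\<And>i t u. cv i (sv t u) = t * cv i u"
    "\<And>i x. ca i (T x) = 0"
    "\<And>BG. is_form_G sg sv T B A r a v BG \<longleftrightarrow>
      BG = (\<lambda>(x, u) (y, u'). B (T (w x)) (w y) + (\<Sum>i=1..r. ca i x * cv i u') + (\<Sum>i=1..r. ca i y * cv i u))"
proof -
  obtain pr w where
    prA: "\<And>x. pr x \<in> A" and dec: "\<And>x. x = pr x + T (w x)"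
    and pr_add: "\<And>x y. pr (x + y) = pr x + pr y" and w_add: "\<And>x y. T (w (x + y)) = T (w x) + T (w y)"
    and pr_sc: "\<And>t x. pr (sg t x) = sg t (pr x)" and w_sc: "\<And>t x. T (w (sg t x)) = sg t (T (w x))"
    and pr_A: "\<And>x. x \<in> A \<Longrightarrow> pr x = x" and w_A: "\<And>x. x \<in> A \<Longrightarrow> T (w x) = 0"
    and pr_T: "\<And>x. pr (T x) = 0" and w_T: "\<And>x. T (w (T x)) = T x"
    by (fact decomposition)
  obtain c where c: "\<And>x. x \<in> A \<Longrightarrow> x = (\<Sum>i=1..r. sg (c i x) (a i))"
    and c_add: "\<And>i x y. x \<in> A \<Longrightarrow> y \<in> A \<Longrightarrow> c i (x + y) = c i x + c i y"
    and c_sc: "\<And>i t x. x \<in> A \<Longrightarrow> c i (sg t x) = t * c i x"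
    and c_a: "\<And>i j. i \<in> {1..r} \<Longrightarrow> j \<in> {1..r} \<Longrightarrow> c i (a j) = (if i = j then 1 else 0)"
    using indexed_basis_coords[OF vector_space_g basis_a] by blast
  obtain cv where cv: "\<And>u. u = (\<Sum>i=1..r. sv (cv i u) (v i))"
    and cv_add: "\<And>i x y. cv i (x + y) = cv i x + cv i y"
    and cv_sc: "\<And>i t x. cv i (sv t x) = t * cv i x"
    and cv_v: "\<And>i j. i \<in> {1..r} \<Longrightarrow> j \<in> {1..r} \<Longrightarrow> cv i (v j) = (if i = j then 1 else 0)"
    using indexed_basis_coords[OF vector_space_V basis_v] by blast
  define ca where "ca i x = c i (pr x)" for i x
  have aA: "a i \<in> A" if "i \<in> {1..r}" for i
    using basis_a that by (auto simp: indexed_basis_def intro: vs1.span_base)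
  have A0: "0 \<in> A"
    using compl by (auto simp: complementary_subspace_def)
  have ca: "pr x = (\<Sum>i=1..r. sg (ca i x) (a i))" for x
    unfolding ca_def by (rule c[OF prA])
  have ca_add: "ca i (x + y) = ca i x + ca i y" for i x y
    by (simp add: ca_def pr_add c_add prA)
  have ca_sc: "ca i (sg t x) = t * ca i x" for i t x
    by (simp add: ca_def pr_sc c_sc prA)
  have ca_a: "ca i (a j) = (if i = j then 1 else 0)" if "i \<in> {1..r}" "j \<in> {1..r}" for i j
    using that by (simp add: ca_def pr_A aA c_a)
  have c0: "c i 0 = 0" for i using c_add[OF A0 A0, of i] by simp
  have cv0: "cv i 0 = 0" for i using cv_add[of i 0 0] by simp
  have ca0: "ca i 0 = 0" for i using ca_add[of i 0 0] by simp
  have ca_T: "ca i (T x) = 0" for i x by (simp add: ca_def pr_T c0)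
  have w0: "T (w 0) = 0" using w_A[OF A0] .
  have B0: "B 0 y = 0" "B y 0 = 0" for y using B_add(1)[of 0 0 y] B_add(2)[of y 0 0] by simp_all
  define F where "F = (\<lambda>(x, u) (y, u'). B (T (w x)) (w y) + (\<Sum>i=1..r. ca i x * cv i u') + (\<Sum>i=1..r. ca i y * cv i u))"
  have Fsym: "F X Y = F Y X" for X Y
  proof -
    have "B (T (w x)) (w y) = B (T (w y)) (w x)" for x y using B_T B_sym by metis
    then show ?thesis by (cases X; cases Y) (simp add: F_def)
  qed
  have F_add: "F (X + X') Y = F X Y + F X' Y" for X X' Y
    by (cases X; cases X'; cases Y) (simp add: F_def w_add B_add ca_add cv_add sum.distrib algebra_simps)
  have F_sc: "F (scale t X) Y = t * F X Y" for t X Y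
    by (cases X; cases Y) (simp add: F_def w_sc B_scale ca_sc cv_sc scale_G sum_distrib_left algebra_simps)
  have vsf: "vector_space ((*) :: 'f \<Rightarrow> 'f \<Rightarrow> 'f)"
    by unfold_locales (simp_all add: algebra_simps)
  have Flin: "symmetric_bilinear_form scale F"
    unfolding symmetric_bilinear_form_def bilinear_map_def Vector_Spaces.linear_iff
    using p.vector_space_axioms vsf F_add F_sc Fsym by metis
  have F: "is_form_G sg sv T B A r a v F"
    unfolding is_form_G_def
  proof (intro conjI allI ballI Flin)
    show "F (T x, 0) (T y, 0) = B (T x) y" for x y
      by (simp add: F_def w_T cv0 B_T_cong[OF w_T])
    show "F (\<alpha>, u) (\<tau>, 0) = 0" if "\<alpha> \<in> A" "\<tau> \<in> range T" for \<alpha> u \<tau>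
      using that by (auto simp: F_def w_A B0 cv0 ca_T)
    show "F (\<alpha>, 0) (\<beta>, 0) = 0" if "\<alpha> \<in> A" "\<beta> \<in> A" for \<alpha> \<beta>
      using that by (auto simp: F_def w_A B0 cv0)
    show "F (0, u) (0, u') = 0" for u u'
      by (simp add: F_def w0 B0 ca0)
    show "F (a i, 0) (0, v j) = (if i = j then 1 else 0)" if "i \<in> {1..r}" "j \<in> {1..r}" for i j
    proof -
      have "(\<Sum>l=1..r. ca l (a i) * cv l (v j)) = (\<Sum>l=1..r. if l = i then cv l (v j) else 0)"
        by (rule sum.cong) (use that in \<open>auto simp: ca_a\<close>)
      also have "\<dots> = cv i (v j)" using that by simp
      finally show ?thesis using that by (simp add: F_def w_A aA B0 cv0 ca0 cv_v)
    qed
  qed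
  have unique: "BG = F" if "is_form_G sg sv T B A r a v BG" for BG
  proof -
    from that have lin1: "Vector_Spaces.linear scale (*) (\<lambda>X. BG X Y)"
      and lin2: "Vector_Spaces.linear scale (*) (\<lambda>Y. BG X Y)"
      and sym: "BG X Y = BG Y X"
      and TT: "BG (T x, 0) (T y, 0) = B (T x) y"
      and AT: "\<alpha> \<in> A \<Longrightarrow> BG (\<alpha>, u) (T x, 0) = 0"
      and AA: "\<alpha> \<in> A \<Longrightarrow> \<beta> \<in> A \<Longrightarrow> BG (\<alpha>, 0) (\<beta>, 0) = 0"
      and VV: "BG (0, u) (0, u') = 0"
      and AV: "i \<in> {1..r} \<Longrightarrow> j \<in> {1..r} \<Longrightarrow> BG (a i, 0) (0, v j) = (if i = j then 1 else 0)"
      for X Y x y \<alpha> \<beta> u u' i j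
      unfolding is_form_G_def symmetric_bilinear_form_def bilinear_map_def by blast+
    note add1 = module_hom.add[OF Vector_Spaces.linear.axioms(3)[OF lin1]]
    note add2 = module_hom.add[OF Vector_Spaces.linear.axioms(3)[OF lin2]]
    have aV: "BG (pr x, 0) (0, u) = (\<Sum>i=1..r. ca i x * cv i u)" for x u
    proof -
      have l1: "Vector_Spaces.linear sg (*) (\<lambda>x. BG (x, 0) (0, u))" for u
        using lin1[of "(0, u)"] vector_space_g
        unfolding Vector_Spaces.linear_iff
        by (metis (no_types, lifting) add_Pair add.right_neutral scale_G vs2.scale_zero_right)
      have l2: "Vector_Spaces.linear sv (*) (\<lambda>u. BG (x, 0) (0, u))" for x
        using lin2[of "(x, 0)"] vector_space_V
        unfolding Vector_Spaces.linear_iff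
        by (metis (no_types, lifting) add_Pair add.right_neutral scale_G vs1.scale_zero_right)
      have av: "BG (a i, 0) (0, u) = cv i u" if i: "i \<in> {1..r}" for i
      proof -
        have "BG (a i, 0) (0, u) = BG (a i, 0) (0, \<Sum>j=1..r. sv (cv j u) (v j))" using cv by metis
        also have "\<dots> = (\<Sum>j=1..r. cv j u * BG (a i, 0) (0, v j))"
          by (rule linear_form_sum[OF l2])
        also have "\<dots> = (\<Sum>j=1..r. if j = i then cv j u else 0)"
          by (rule sum.cong) (use i in \<open>auto simp: AV\<close>)
        also have "\<dots> = cv i u" using i by simp
        finally show ?thesis .
      qed
      have "BG (pr x, 0) (0, u) = (\<Sum>i=1..r. ca i x * BG (a i, 0) (0, u))"
        unfolding ca by (rule linear_form_sum[OF l1])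
      then show ?thesis by (simp add: av)
    qed
    have "BG (x, u) (y, u') = F (x, u) (y, u')" for x u y u'
    proof -
      have X: "(x, u) = (pr x, 0) + ((T (w x), 0) + (0, u))" using dec[of x] by simp
      have Y: "(y, u') = (pr y, 0) + ((T (w y), 0) + (0, u'))" using dec[of y] by simp
      have z: "BG (T z, 0) (\<alpha>, u) = 0" if "\<alpha> \<in> A" for z \<alpha> u using AT[OF that] sym by metis
      have "BG (x, u) (y, u') = BG (T (w x), 0) (T (w y), 0) + BG (pr x, 0) (0, u') + BG (0, u) (pr y, 0)"
        by (subst X, subst Y) (simp only: add1 add2 AA[OF prA prA] AT[OF prA] AT[OF A0] z[OF prA] z[OF A0] VV, simp)
      also have "BG (0, u) (pr y, 0) = BG (pr y, 0) (0, u)" by (rule sym)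
      finally show ?thesis by (simp add: aV TT F_def)
    qed
    then show ?thesis by (auto simp: fun_eq_iff)
  qed
  have iff: "is_form_G sg sv T B A r a v BG \<longleftrightarrow> BG = F" for BG
    using F unique by blast
  show thesis
    by (rule that[OF dec pr_T w_T ca cv cv_v cv_add cv_sc ca_T iff[unfolded F_def]])
qed

lemma form_G_ex1: "\<exists>!BG. is_form_G sg sv T B A r a v BG"
proof (rule form_formula)
  fix w ca cv
  assume "\<And>BG. is_form_G sg sv T B A r a v BG \<longleftrightarrow>
    BG = (\<lambda>(x, u) (y, u'). B (T (w x)) (w y) + (\<Sum>i=1..r. ca i x * cv i u') + (\<Sum>i=1..r. ca i y * cv i u))"
  then show ?thesis by simp
qed

lemma fin_dim_G: "fin_dim (module_prod.scale sg sv)"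
proof -
  obtain B1 where "finite_dimensional_vector_space sg B1"
    using quad by (auto simp: quadratic_hom_lie_algebra_def hom_lie_algebra_def fin_dim_def)
  then interpret f1: finite_dimensional_vector_space sg B1 .
  obtain B2 where "finite_dimensional_vector_space sv B2"
    using fin_dim_V by (auto simp: fin_dim_def)
  then interpret f2: finite_dimensional_vector_space sv B2 .
  interpret f: finite_dimensional_vector_space_prod sg sv B1 B2
    by unfold_locales
  show ?thesis unfolding fin_dim_def using f.p.finite_dimensional_vector_space_axioms by blast
qed

lemma quadratic_lie_algebra_G:
  assumes cent: "in_centroid \<mu> T" and BG: "is_form_G sg sv T B A r a v BG"
  shows "quadratic_lie_algebra (module_prod.scale sg sv) (bracket_G (k_map sv T B r a v) \<mu>) BG"
proof -
  let ?k = "k_map sv T B r a v"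
  have \<mu>bil: "bilinear_map sg sg \<mu>" and \<mu>skew: "\<mu> x y = - \<mu> y x"
    and hj: "\<mu> (T x) (\<mu> y z) + \<mu> (T y) (\<mu> z x) + \<mu> (T z) (\<mu> x y) = 0" for x y z
    using quad unfolding quadratic_hom_lie_algebra_def hom_lie_algebra_def by blast+
  have \<mu>add: "\<mu> (x + x') y = \<mu> x y + \<mu> x' y" "\<mu> x (y + y') = \<mu> x y + \<mu> x y'"
    and \<mu>sc: "\<mu> (sg t x) y = sg t (\<mu> x y)" "\<mu> x (sg t y) = sg t (\<mu> x y)" for x x' y y' t
    using \<mu>bil by (simp_all add: bilinear_map_def Vector_Spaces.linear_iff)
  have B0: "B x 0 = 0" for x using B_add(2)[of x 0 0] by simp
  have T0: "T 0 = 0" using T_add[of 0 0] by simp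
  have k_add: "?k (x + y) = ?k x + ?k y" for x y
    by (simp add: k_map_def T_add B_add vs2.scale_left_distrib sum.distrib)
  have k_sc: "?k (sg t x) = scale t (?k x)" for t x
    by (simp add: k_map_def T_scale B_scale scale_G vs2.scale_sum_right)
  have k0: "?k 0 = 0" by (simp add: k_map_def T0 B0 zero_prod_def)
  have BGsym: "symmetric_bilinear_form scale BG" using BG by (simp add: is_form_G_def)
  then have sym: "BG X Y = BG Y X" for X Y unfolding symmetric_bilinear_form_def by blast
  have key: "BG (?k x) Y = B x (fst Y) \<and> ((\<forall>Z. BG X Z = 0) \<longrightarrow> fst X = 0 \<longrightarrow> X = 0)" for x X Y
  proof (rule form_formula)
    fix pr w ca cv
    assume dec: "\<And>x. x = pr x + T (w x)" and pr_T: "\<And>x. pr (T x) = 0" and w_T: "\<And>x. T (w (T x)) = T x"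
      and ca: "\<And>x. pr x = (\<Sum>i=1..r. sg (ca i x) (a i))"
      and cv: "\<And>u. u = (\<Sum>i=1..r. sv (cv i u) (v i))"
      and cv_v: "\<And>i j. i \<in> {1..r} \<Longrightarrow> j \<in> {1..r} \<Longrightarrow> cv i (v j) = (if i = j then 1 else 0)"
      and cv_add: "\<And>i u u'. cv i (u + u') = cv i u + cv i u'" and cv_sc: "\<And>i t u. cv i (sv t u) = t * cv i u"
      and ca_T: "\<And>i x. ca i (T x) = 0"
      and form: "\<And>BG. is_form_G sg sv T B A r a v BG \<longleftrightarrow>
        BG = (\<lambda>(x, u) (y, u'). B (T (w x)) (w y) + (\<Sum>i=1..r. ca i x * cv i u') + (\<Sum>i=1..r. ca i y * cv i u))"
    have BGeq: "BG (x, u) (y, u') = B (T (w x)) (w y) + (\<Sum>i=1..r. ca i x * cv i u') + (\<Sum>i=1..r. ca i y * cv i u)"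
      for x u y u' using BG form by auto
    obtain y u' where Y: "Y = (y, u')" by (cases Y)
    have cv0: "cv i 0 = 0" for i using cv_add[of i 0 0] by simp
    have cvsum: "cv i (\<Sum>j=1..r. sv (f j) (v j)) = f i" if i: "i \<in> {1..r}" for i f
    proof -
      have "cv i (\<Sum>j\<in>S. sv (f j) (v j)) = (\<Sum>j\<in>S. f j * cv i (v j))" if "finite S" for S
        using that by (induction S) (simp_all add: cv0 cv_add cv_sc)
      then have "cv i (\<Sum>j=1..r. sv (f j) (v j)) = (\<Sum>j=1..r. f j * cv i (v j))" by simp
      also have "\<dots> = (\<Sum>j=1..r. if j = i then f j else 0)"
        by (rule sum.cong) (use i in \<open>auto simp: cv_v\<close>)
      finally show ?thesis using i by simp
    qed
    have "(\<Sum>i=1..r. ca i y * cv i (\<Sum>j=1..r. sv (B (a j) x) (v j))) = (\<Sum>i=1..r. ca i y * B (a i) x)"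
      by (rule sum.cong[OF refl], subst cvsum) auto
    then have "BG (?k x) Y = B (T x) (w y) + (\<Sum>i=1..r. ca i y * B (a i) x)"
      by (simp add: Y k_map_def BGeq w_T ca_T)
    also have "(\<Sum>i=1..r. ca i y * B (a i) x) = B (pr y) x"
      unfolding ca by (rule linear_form_sum[OF linear_B(2), symmetric])
    also have "B (T x) (w y) + B (pr y) x = B x (pr y + T (w y))"
      by (simp add: B_T B_add B_sym[of _ x])
    also have "\<dots> = B x (fst Y)" using dec[of y] by (simp add: Y)
    finally have 1: "BG (?k x) Y = B x (fst Y)" .
    have 2: "X = 0" if Z: "\<And>Z. BG X Z = 0" and X0: "fst X = 0" for X
    proof -
      obtain u where X: "X = (0, u)" using X0 by (cases X) auto
      have AV: "BG (a i, 0) (0, v j) = (if i = j then 1 else 0)" if "i \<in> {1..r}" "j \<in> {1..r}" for i j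
        using BG that by (simp add: is_form_G_def)
      have VV: "BG (0, u) (0, u') = 0" for u u' using BG by (simp add: is_form_G_def)
      have ca0: "ca i 0 = 0" for i using ca_T[of i 0] by (simp add: T0)
      have w0: "T (w 0) = 0" using w_T[of 0] by (simp add: T0)
      have caa: "ca i (a j) = (if j = i then 1 else 0)" if "i \<in> {1..r}" "j \<in> {1..r}" for i j
      proof -
        have "B (T (w (a j))) (w 0) = 0" using w0 by (simp add: B_T B0)
        then have "BG (a j, 0) (0, v i) = (\<Sum>l=1..r. ca l (a j) * cv l (v i))"
          by (simp add: BGeq ca0 cv0)
        also have "\<dots> = (\<Sum>l=1..r. if l = i then ca l (a j) else 0)"
          by (rule sum.cong) (use that in \<open>auto simp: cv_v\<close>)
        finally show ?thesis using that by (simp add: AV)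
      qed
      have "cv i u = 0" if i: "i \<in> {1..r}" for i
      proof -
        have "B 0 y = 0" for y using B0[of y] B_sym[of 0 y] by simp
        then have "0 = (\<Sum>l=1..r. ca l (a i) * cv l u)"
          using Z[of "(a i, 0)"] by (simp add: X BGeq w0 ca0)
        also have "\<dots> = (\<Sum>l=1..r. if l = i then cv l u else 0)"
          by (rule sum.cong) (use i in \<open>auto simp: caa\<close>)
        finally show ?thesis using i by simp
      qed
      then have "u = 0" using cv[of u] by simp
      then show ?thesis by (simp add: X zero_prod_def)
    qed
    show ?thesis using 1 2 by blast
  qed
  have kB: "BG (?k x) Y = B x (fst Y)" for x Y using key by blast
  have kB': "BG X (?k y) = B (fst X) y" for X y using kB[of y X] sym B_sym by metis
  have \<mu>T: "\<mu> x (T w) = \<mu> (T x) w" for x w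
  proof -
    have "T (\<mu> x w) + T (\<mu> w x) = 0"
      using T_add[of "\<mu> x w" "\<mu> w x"] \<mu>skew[of x w] by (simp add: T0)
    then have "\<mu> (T x) w + \<mu> (T w) x = 0" using cent by (simp add: in_centroid_def)
    then show ?thesis using \<mu>skew[of x "T w"] by (metis eq_neg_iff_add_eq_0)
  qed
  have \<mu>0: "\<mu> x x = 0" for x
  proof -
    have "\<mu> x x + \<mu> x x = 0" by (subst \<mu>skew) simp
    then have "sg 2 (\<mu> x x) = 0" by (metis one_add_one vs1.scale_left_distrib vs1.scale_one)
    then show ?thesis by simp
  qed
  have fst_k: "fst (?k x) = T x" for x by (simp add: k_map_def)
  have fst_sc: "fst (scale t X) = sg t (fst X)" for t X by (cases X) (simp add: scale_G)
  have "bilinear_map scale scale (bracket_G ?k \<mu>)"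
    unfolding bilinear_map_def Vector_Spaces.linear_iff
    using p.vector_space_axioms by (simp add: bracket_G_def \<mu>add \<mu>sc k_add k_sc fst_sc)
  moreover have "?k (\<mu> (T x) (\<mu> y z)) + ?k (\<mu> (T y) (\<mu> z x)) + ?k (\<mu> (T z) (\<mu> x y)) = 0" for x y z
    by (simp only: k_add[symmetric] hj k0)
  ultimately have "lie_algebra scale (bracket_G ?k \<mu>)"
    unfolding lie_algebra_def using fin_dim_G by (simp add: bracket_G_def \<mu>0 k0 fst_k \<mu>T)
  moreover have "nondegenerate_form BG"
    unfolding nondegenerate_form_def
  proof (intro allI impI)
    fix X assume Z: "\<forall>Y. BG X Y = 0"
    then have "B (fst X) y = 0" for y using kB'[of X y] by metis
    then have "fst X = 0" by (rule B_nondeg)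
    with Z key show "X = 0" by blast
  qed
  ultimately show ?thesis
    using BGsym unfolding quadratic_lie_algebra_def by (simp add: bracket_G_def kB kB' B_inv)
qed

end

end

theory Submission
  imports Defs
begin

text \<open>The map \<open>k\<close> is designed so that \<open>B\<^sub>\<GG>(k(x), y + v) = B(x, y)\<close>: writing \<open>y = \<alpha> + T(z)\<close> with
  \<open>\<alpha> \<in> \<aa>\<close>, the component \<open>T(x)\<close> of \<open>k(x)\<close> pairs only with \<open>T(z)\<close>, giving \<open>B(T(x), z) = B(x, T(z))\<close>,
  and the component in \<open>V\<close> pairs only with \<open>\<alpha>\<close>, giving \<open>B(\<alpha>, x)\<close>. All other claims only involve the
  \<open>\<gg>\<close>-components, on which \<open>\<mu>\<^sub>\<GG>\<close> and \<open>L\<close> act as \<open>\<mu>\<close> and \<open>T\<close>.\<close>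

context form_G_setting
begin

lemma form_G_linear:
  assumes "is_form_G sg sv T B A r a v BG"
  shows "Vector_Spaces.linear scale (*) (BG X)" "Vector_Spaces.linear scale (*) (\<lambda>X. BG X Y)"
  using assms
  by (simp_all add: is_form_G_def symmetric_bilinear_form_def bilinear_map_def del: split_paired_All)

lemma form_G_sym:
  assumes "is_form_G sg sv T B A r a v BG"
  shows "BG X Y = BG Y X"
  using assms unfolding is_form_G_def symmetric_bilinear_form_def by blast

text \<open>\<open>BG\<close> makes \<open>a\<close> and \<open>v\<close> dual to each other, so the
  \<open>V\<close>-component of \<open>k(x)\<close>, whose coordinates are the values
  \<open>B (a i) x\<close>, represents the functional \<open>B _ x\<close> on \<open>A\<close>. It
  suffices to check this on the basis \<open>a\<close>.\<close>

lemma form_G_pairing: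
  assumes BG: "is_form_G sg sv T B A r a v BG" and \<alpha>: "\<alpha> \<in> A"
  shows "BG (\<alpha>, 0) (0, \<Sum>i=1..r. sv (B (a i) x) (v i)) = B \<alpha> x"
proof -
  let ?S = "\<Sum>i=1..r. sv (B (a i) x) (v i)"
  \<comment> \<open>The inclusions of both summands commute with addition and scaling, so linearity
    of \<open>BG\<close> restricts to each summand.\<close>
  have l1: "Vector_Spaces.linear sg (*) (\<lambda>x. BG (x, 0) (0, u))" for u
    using form_G_linear(2)[OF BG, of "(0, u)"] vector_space_g
    unfolding Vector_Spaces.linear_iff
    by (metis (no_types, lifting) add_Pair add.right_neutral scale_G vs2.scale_zero_right)
  have l2: "Vector_Spaces.linear sv (*) (\<lambda>u. BG (x, 0) (0, u))" for x
    using form_G_linear(1)[OF BG, of "(x, 0)"] vector_space_V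
    unfolding Vector_Spaces.linear_iff
    by (metis (no_types, lifting) add_Pair add.right_neutral scale_G vs1.scale_zero_right)
  have basis: "BG (a i, 0) (0, ?S) = B (a i) x" if i: "i \<in> {1..r}" for i
  proof -
    have "BG (a i, 0) (0, ?S) = (\<Sum>j=1..r. B (a j) x * BG (a i, 0) (0, v j))"
      by (rule linear_form_sum[OF l2])
    \<comment> \<open>Duality of \<open>a\<close> and \<open>v\<close> leaves only the term j =
      i.\<close>
    also have "\<dots> = (\<Sum>j=1..r. if j = i then B (a j) x else 0)"
      by (rule sum.cong) (use i BG in \<open>auto simp: is_form_G_def\<close>)
    finally show ?thesis using i by simp
  qed
  obtain c where c: "\<alpha> = (\<Sum>i=1..r. sg (c i \<alpha>) (a i))"
    using indexed_basis_coords[OF vector_space_g basis_a] \<alpha> by blast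
  have "BG (\<Sum>i=1..r. sg (c i \<alpha>) (a i), 0) (0, ?S) = (\<Sum>i=1..r. c i \<alpha> * BG (a i, 0) (0, ?S))"
    by (rule linear_form_sum[OF l1])
  also have "\<dots> = (\<Sum>i=1..r. c i \<alpha> * B (a i) x)"
    by (rule sum.cong) (simp_all only: basis)
  also have "\<dots> = B (\<Sum>i=1..r. sg (c i \<alpha>) (a i)) x"
    by (rule linear_form_sum[OF linear_B(2), symmetric])
  finally show ?thesis unfolding c[symmetric] .
qed

text \<open>This yields both identities for \<open>L\<close>. The defining conditions of
  \<open>BG\<close> suffice for it, without an explicit formula for the form.\<close>

lemma form_G_k_map:
  assumes BG: "is_form_G sg sv T B A r a v BG"
  shows "BG (k_map sv T B r a v x) Y = B x (fst Y)"
proof -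
  obtain y w where Y: "Y = (y, w)" by (cases Y)
  let ?S = "\<Sum>i=1..r. sv (B (a i) x) (v i)"
  have "y \<in> {x + y | x y. x \<in> A \<and> y \<in> range T}"
    using compl by (simp add: complementary_subspace_def)
  then obtain \<alpha> z where \<alpha>: "\<alpha> \<in> A" and y: "y = \<alpha> + T z" by auto
  \<comment> \<open>Taking 0 in \<open>A\<close> specialises the orthogonality of \<open>A\<close> +
    \<open>V\<close> and \<open>range T\<close> to that of \<open>V\<close> and
    \<open>range T\<close>.\<close>
  have A0: "0 \<in> A" using compl by (auto simp: complementary_subspace_def)
  note add1 = module_hom.add[OF Vector_Spaces.linear.axioms(3)[OF form_G_linear(2)[OF BG]]]
  note add2 = module_hom.add[OF Vector_Spaces.linear.axioms(3)[OF form_G_linear(1)[OF BG]]]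
  have AT: "BG (\<beta>, u) (T t, 0) = 0" if "\<beta> \<in> A" for \<beta> u t
    using BG that by (simp add: is_form_G_def)
  have TA: "BG (T t, 0) (\<beta>, u) = 0" if "\<beta> \<in> A" for \<beta> u t
    using AT[OF that] by (subst form_G_sym[OF BG])
  have TT: "BG (T x, 0) (T z, 0) = B (T x) z" and VV: "BG (0, ?S) (0, w) = 0"
    using BG by (simp_all add: is_form_G_def)
  have VA: "BG (0, ?S) (\<alpha>, 0) = B \<alpha> x"
    using form_G_pairing[OF BG \<alpha>] by (subst form_G_sym[OF BG])
  have k: "k_map sv T B r a v x = (T x, 0) + (0, ?S)" by (simp add: k_map_def)
  have Y': "Y = (\<alpha>, 0) + ((T z, 0) + (0, w))" by (simp add: Y y)
  have "BG (k_map sv T B r a v x) Y = B (T x) z + B \<alpha> x"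
    \<comment> \<open>Of the six products, only \<open>T x\<close> with \<open>T z\<close> and
      \<open>?S\<close> with \<alpha> survive.\<close>
    unfolding k Y' by (simp only: add1 add2 TA[OF \<alpha>] TA[OF A0] AT[OF A0] TT VV VA, simp)
  also have "\<dots> = B x (fst Y)"
    by (simp add: Y y B_add B_T B_sym[of \<alpha> x])
  finally show ?thesis .
qed

lemma linear_k_map: "Vector_Spaces.linear sg scale (k_map sv T B r a v)"
  unfolding Vector_Spaces.linear_iff using vector_space_g p.vector_space_axioms
  by (simp add: k_map_def T_add T_scale B_add B_scale scale_G vs2.scale_left_distrib
      vs2.scale_sum_right sum.distrib)

lemma linear_fst_G: "Vector_Spaces.linear scale sg fst"
  unfolding Vector_Spaces.linear_iff using vector_space_g p.vector_space_axioms
  by (auto simp: scale_G)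

text \<open>Since \<open>fst\<close> of \<open>k(x)\<close> is \<open>T x\<close>, the first
  component of the twisted Jacobi sum is the one for \<mu> and \<open>T\<close>; the second vanishes
  because \<open>mu_G\<close> has values in the first summand.\<close>

lemma hom_lie_algebra_G: "hom_lie_algebra scale (mu_G \<mu>) (L_G (k_map sv T B r a v))"
proof -
  have bil: "bilinear_map sg sg \<mu>" and skew: "\<mu> x y = - \<mu> y x"
    and jac: "\<mu> (T x) (\<mu> y z) + \<mu> (T y) (\<mu> z x) + \<mu> (T z) (\<mu> x y) = 0" for x y z
    using quad unfolding quadratic_hom_lie_algebra_def hom_lie_algebra_def by blast+
  have "bilinear_map scale scale (mu_G \<mu>)"
    using bil p.vector_space_axioms
    by (auto simp: bilinear_map_def Vector_Spaces.linear_iff mu_G_def scale_G)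
  moreover have "mu_G \<mu> X Y = - mu_G \<mu> Y X" for X Y :: "'g \<times> 'v"
    using skew[of "fst X" "fst Y"] by (simp add: mu_G_def)
  moreover have "Vector_Spaces.linear scale scale (L_G (k_map sv T B r a v))"
    using Vector_Spaces.linear_compose[OF linear_fst_G linear_k_map]
    by (simp add: L_G_def[abs_def] comp_def)
  moreover have "mu_G \<mu> (L_G (k_map sv T B r a v) X) (mu_G \<mu> Y Z)
      + mu_G \<mu> (L_G (k_map sv T B r a v) Y) (mu_G \<mu> Z X)
      + mu_G \<mu> (L_G (k_map sv T B r a v) Z) (mu_G \<mu> X Y) = (0 :: 'g \<times> 'v)" for X Y Z
    using jac by (simp add: mu_G_def L_G_def k_map_def zero_prod_def)
  ultimately show ?thesis
    unfolding hom_lie_algebra_def using fin_dim_G by blast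
qed

lemma hom_lie_epimorphism_fst:
  "hom_lie_epimorphism scale (mu_G \<mu>) (L_G (k_map sv T B r a v)) sg \<mu> T fst"
  using hom_lie_algebra_G quad linear_fst_G
  by (auto simp: hom_lie_epimorphism_def hom_lie_morphism_def quadratic_hom_lie_algebra_def
      mu_G_def L_G_def k_map_def fun_eq_iff)

end

theorem proposition1p4:
  fixes sg :: "'f::{alg_closed_field, field_char_0} \<Rightarrow> 'g::ab_group_add \<Rightarrow> 'g"
    and \<mu> :: "'g \<Rightarrow> 'g \<Rightarrow> 'g" and T :: "'g \<Rightarrow> 'g" and B :: "'g \<Rightarrow> 'g \<Rightarrow> 'f"
    and sv :: "'f \<Rightarrow> 'v::ab_group_add \<Rightarrow> 'v"
    and r :: nat and A :: "'g set" and a :: "nat \<Rightarrow> 'g" and v :: "nat \<Rightarrow> 'v"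
    and BG :: "'g \<times> 'v \<Rightarrow> 'g \<times> 'v \<Rightarrow> 'f"
    and k :: "'g \<Rightarrow> 'g \<times> 'v" and L :: "'g \<times> 'v \<Rightarrow> 'g \<times> 'v"
    and sG :: "'f \<Rightarrow> 'g \<times> 'v \<Rightarrow> 'g \<times> 'v"
  defines "sG \<equiv> module_prod.scale sg sv"
    and "k \<equiv> k_map sv T B r a v"
    and "L \<equiv> L_G k"
  assumes "quadratic_hom_lie_algebra sg \<mu> T B"
    and "in_centroid \<mu> T"
    and "vector_space.dim sg {x. T x = 0} = r" and "r > 0"
    and "fin_dim sv" and "vector_space.dim sv (UNIV :: 'v set) = r"
    and "complementary_subspace sg A (range T)"
    and "indexed_basis sg r a A"
    and "indexed_basis sv r v UNIV"
    and "is_form_G sg sv T B A r a v BG"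
  shows "hom_lie_algebra sG (mu_G \<mu>) L
    \<and> (\<forall>x y u w. BG (L (x, u)) (y, w) = BG (x, u) (L (y, w)) \<and> BG (x, u) (L (y, w)) = B x y)
    \<and> hom_lie_epimorphism sG (mu_G \<mu>) L sg \<mu> T fst"
proof -
  interpret form_G_setting sg \<mu> T B sv r A a v
    by (rule form_G_setting.intro) fact+
  note BG = \<open>is_form_G sg sv T B A r a v BG\<close>
  have left: "BG (L (x, u)) (y, w) = B x y" for x u y w
    by (simp add: L_def k_def L_G_def form_G_k_map[OF BG])
  \<comment> \<open>Symmetry of \<open>BG\<close> moves \<open>L\<close> to the first argument, and
    symmetry of \<open>B\<close> restores the order of x and y.\<close>
  have right: "BG (x, u) (L (y, w)) = B x y" for x u y w
    using form_G_sym[OF BG, of "(x, u)" "L (y, w)"] left[of y w x u] B_sym[of y x] by simp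
  from left right show ?thesis
    using hom_lie_algebra_G hom_lie_epimorphism_fst unfolding sG_def L_def k_def by simp
qed

end
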